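(* Let $(S,+,\cdot,\mu)$ be a near left semibrace, and let $e$ be the identity of the group $(S,\cdot)$. For $a,b\in S$ put $\lambda_a(b)=a(a^{-1}\mu(e)+b)$ and $\rho_b(a)=(a^{-1}\mu(e)+b)^{-1}b$. The map $r_S:S\times S\to S\times S$ defined by $r_S(a,b)=(\lambda_a(b),\rho_b(a))$ for all $a,b\in S$ is a set-theoretic solution of the Yang-Baxter equation if and only if $$\bigl(a\mu(e)+\mu(b)+bc\bigr)\mu(e)+\mu\bigl(\mu(e)+\mu(b)+bc\bigr)+bc=\bigl(a\mu(e)+b\bigr)\mu(e)+\mu(b)+bc$$ for all $a,b,c\in S$.
   Context: Multiplication has higher precedence than addition. A near left semibrace is a quadruple $(S,+,\cdot,\mu)$ where $(S,+)$ is a (not necessarily commutative) semigroup, $(S,\cdot)$ is a group, and $\mu:S\to S$ is a map such that $x(y+z)=xy+\mu(x)+xz$ for all $x,y,z\in S$. Inverses $x^{-1}$ are taken in the group $(S,\cdot)$. A map $r:S\times S\to S\times S$ is a set-theoretic solution of the Yang-Baxter equation if $(r\times\mathrm{id}_S)(\mathrm{id}_S\times r)(r\times\mathrm{id}_S)=(\mathrm{id}_S\times r)(r\times\mathrm{id}_S)(\mathrm{id}_S\times r)$ as maps $S\times S\times S\to S\times S\times S$ (no bijectivity is required). *)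

theory Defs
  imports "HOL-Algebra.Group"
begin

record 'a near_semibrace = "'a monoid" +
  splus :: "'a \<Rightarrow> 'a \<Rightarrow> 'a" (infixl "\<boxplus>\<index>" 65)
  smu :: "'a \<Rightarrow> 'a" ("\<mu>\<index>")

locale near_left_semibrace = group S
  for S :: "('a, 'b) near_semibrace_scheme" (structure) +
  assumes splus_closed [simp, intro]:
      "\<lbrakk>x \<in> carrier S; y \<in> carrier S\<rbrakk> \<Longrightarrow> x \<boxplus> y \<in> carrier S"
    and splus_assoc:
      "\<lbrakk>x \<in> carrier S; y \<in> carrier S; z \<in> carrier S\<rbrakk>
        \<Longrightarrow> (x \<boxplus> y) \<boxplus> z = x \<boxplus> (y \<boxplus> z)"
    and smu_closed [simp, intro]: "x \<in> carrier S \<Longrightarrow> \<mu> x \<in> carrier S"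
    and near_distrib:
      "\<lbrakk>x \<in> carrier S; y \<in> carrier S; z \<in> carrier S\<rbrakk>
        \<Longrightarrow> x \<otimes> (y \<boxplus> z) = x \<otimes> y \<boxplus> \<mu> x \<boxplus> x \<otimes> z"

definition slambda :: "('a, 'b) near_semibrace_scheme \<Rightarrow> 'a \<Rightarrow> 'a \<Rightarrow> 'a" where
  "slambda S a b = a \<otimes>\<^bsub>S\<^esub> (inv\<^bsub>S\<^esub> a \<otimes>\<^bsub>S\<^esub> \<mu>\<^bsub>S\<^esub> \<one>\<^bsub>S\<^esub> \<boxplus>\<^bsub>S\<^esub> b)"

text \<open>The subscript comes first: \<^term>\<open>srho S b a\<close> is $\rho_b(a)$.\<close>

definition srho :: "('a, 'b) near_semibrace_scheme \<Rightarrow> 'a \<Rightarrow> 'a \<Rightarrow> 'a" where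
  "srho S b a = inv\<^bsub>S\<^esub> (inv\<^bsub>S\<^esub> a \<otimes>\<^bsub>S\<^esub> \<mu>\<^bsub>S\<^esub> \<one>\<^bsub>S\<^esub> \<boxplus>\<^bsub>S\<^esub> b) \<otimes>\<^bsub>S\<^esub> b"

definition semibrace_map :: "('a, 'b) near_semibrace_scheme \<Rightarrow> 'a \<times> 'a \<Rightarrow> 'a \<times> 'a" where
  "semibrace_map S = (\<lambda>(a, b). (slambda S a b, srho S b a))"

text \<open>$r \times \mathrm{id}$ and $\mathrm{id} \times r$ on triples, which associate to the right.\<close>

definition r_times_id :: "('a \<times> 'a \<Rightarrow> 'a \<times> 'a) \<Rightarrow> 'a \<times> 'a \<times> 'a \<Rightarrow> 'a \<times> 'a \<times> 'a" where
  "r_times_id r = (\<lambda>(x, y, z). case r (x, y) of (u, v) \<Rightarrow> (u, v, z))"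

definition id_times_r :: "('a \<times> 'a \<Rightarrow> 'a \<times> 'a) \<Rightarrow> 'a \<times> 'a \<times> 'a \<Rightarrow> 'a \<times> 'a \<times> 'a" where
  "id_times_r r = (\<lambda>(x, y, z). (x, r (y, z)))"

definition YBE_solution :: "'a set \<Rightarrow> ('a \<times> 'a \<Rightarrow> 'a \<times> 'a) \<Rightarrow> bool" where
  "YBE_solution X r \<longleftrightarrow>
     r \<in> X \<times> X \<rightarrow> X \<times> X \<and>
     (\<forall>t \<in> X \<times> X \<times> X.
        (r_times_id r \<circ> id_times_r r \<circ> r_times_id r) t
      = (id_times_r r \<circ> r_times_id r \<circ> id_times_r r) t)"

end

theory Submission
  imports Defs
begin

text \<open>
  Write \<open>z = \<mu> \<one>\<close>. Taking \<open>x = \<one>\<close> in the distributive law gives \<open>y \<boxplus> z \<boxplus> w = y \<boxplus> w\<close>: the element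
  \<open>z\<close> can be dropped between two summands. It follows that
  \<open>\<lambda>\<close> is an action of the multiplicative group by self-maps (\<open>slambda_slambda\<close>; the unit acts as
  \<open>b \<mapsto> z \<boxplus> b\<close>, not necessarily as the identity). Moreover, \<open>\<rho>\<close> is defined so that
  \<open>\<lambda>\<^sub>a(b) \<rho>\<^sub>b(a) = a b\<close> (\<open>slambda_mult_srho\<close>), so \<open>r\<close> preserves the product of a pair, and both
  sides of the Yang-Baxter equation preserve the product of a triple.

  Let both sides act on \<open>(a, b, c)\<close>. The first components both equal
  \<open>\<lambda>\<^bsub>ab\<^esub>(c)\<close>. Since the products agree too, cancellation in the group shows that the
  triples are equal as soon as their third components are. The whole equation is therefore
  \<open>\<rho>\<^sub>c(\<rho>\<^sub>b(a)) = \<rho>\<^sub>d(\<rho>\<^bsub>l\<^esub>(a))\<close> with \<open>l = \<lambda>\<^sub>b(c)\<close> and \<open>d = \<rho>\<^sub>c(b)\<close>. Inverting both sides and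
  multiplying by \<open>b c = l d\<close> from the left removes all quotients and leaves the identity of the
  theorem, with the inverse of \<open>a\<close> in place of \<open>a\<close> (\<open>srho_srho_eq_iff\<close>); inversion is a bijection
  of the group, so the quantification over \<open>a\<close> absorbs this change.
\<close>

context near_left_semibrace
begin

lemma splus_smu_one_splus:
  assumes "x \<in> carrier S" "y \<in> carrier S"
  shows "x \<boxplus> \<mu> \<one> \<boxplus> y = x \<boxplus> y"
  using near_distrib[of \<one> x y] assms by simp

lemma slambda_closed [simp, intro]:
  "\<lbrakk>a \<in> carrier S; b \<in> carrier S\<rbrakk> \<Longrightarrow> slambda S a b \<in> carrier S"
  by (simp add: slambda_def)

lemma srho_closed [simp, intro]:
  "\<lbrakk>a \<in> carrier S; b \<in> carrier S\<rbrakk> \<Longrightarrow> srho S b a \<in> carrier S"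
  by (simp add: srho_def)

lemma mult_inv_mult_splus:
  assumes "a \<in> carrier S" "x \<in> carrier S" "y \<in> carrier S"
  shows "a \<otimes> (inv a \<otimes> x \<boxplus> y) = x \<boxplus> \<mu> a \<boxplus> a \<otimes> y"
  using near_distrib[of a "inv a \<otimes> x" y] assms by (simp add: m_assoc [symmetric])

lemma slambda_eq:
  assumes "a \<in> carrier S" "b \<in> carrier S"
  shows "slambda S a b = \<mu> \<one> \<boxplus> \<mu> a \<boxplus> a \<otimes> b"
  unfolding slambda_def using assms by (simp add: mult_inv_mult_splus)

lemma splus_slambda:
  assumes "x \<in> carrier S" "a \<in> carrier S" "b \<in> carrier S"
  shows "x \<boxplus> slambda S a b = x \<boxplus> \<mu> a \<boxplus> a \<otimes> b"
  using assms splus_smu_one_splus[of x "\<mu> a"]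
  by (simp add: slambda_eq splus_assoc [symmetric])

text \<open>The term \<open>\<mu> \<one>\<close> that \<open>\<lambda>\<^sub>b\<close> puts in front disappears behind the first summand in \<open>\<lambda>\<^sub>a\<close>,
  and what remains is \<open>b\<close> distributed over the sum in \<open>\<lambda>\<^bsub>ab\<^esub>(c)\<close>.\<close>

lemma slambda_slambda:
  assumes "a \<in> carrier S" "b \<in> carrier S" "c \<in> carrier S"
  shows "slambda S a (slambda S b c) = slambda S (a \<otimes> b) c"
proof -
  have "slambda S (a \<otimes> b) c
      = a \<otimes> (b \<otimes> (inv b \<otimes> (inv a \<otimes> \<mu> \<one>) \<boxplus> c))"
    using assms by (simp add: slambda_def inv_mult_group m_assoc)
  also have "\<dots> = a \<otimes> (inv a \<otimes> \<mu> \<one> \<boxplus> \<mu> b \<boxplus> b \<otimes> c)"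
    using assms by (simp add: mult_inv_mult_splus)
  also have "\<dots> = slambda S a (slambda S b c)"
    using assms by (simp add: slambda_def [of S a] splus_slambda)
  finally show ?thesis ..
qed

lemma slambda_mult_srho:
  assumes "a \<in> carrier S" "b \<in> carrier S"
  shows "slambda S a b \<otimes> srho S b a = a \<otimes> b"
proof -
  have "(inv a \<otimes> \<mu> \<one> \<boxplus> b) \<otimes> (inv (inv a \<otimes> \<mu> \<one> \<boxplus> b) \<otimes> b) = b"
    using assms by (simp add: m_assoc [symmetric])
  then show ?thesis
    using assms by (simp add: slambda_def srho_def m_assoc)
qed

lemma inv_srho:
  assumes "a \<in> carrier S" "b \<in> carrier S"
  shows "inv (srho S b a) = inv b \<otimes> (inv a \<otimes> \<mu> \<one> \<boxplus> b)"
  using assms by (simp add: srho_def inv_mult_group)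

text \<open>Inverting \<open>\<rho>\<^sub>d(\<rho>\<^sub>l(a))\<close> and multiplying by the product \<open>l d\<close> of the subscripts lets the
  group inverses of \<open>d\<close> and \<open>l\<close> cancel, so that only sums remain. Both sides of the Yang-Baxter equation
  have third components of this form, with the same product of subscripts.\<close>

lemma mult_inv_srho_srho:
  assumes "a \<in> carrier S" "l \<in> carrier S" "d \<in> carrier S"
  shows "l \<otimes> d \<otimes> inv (srho S d (srho S l a))
    = (inv a \<otimes> \<mu> \<one> \<boxplus> l) \<otimes> \<mu> \<one> \<boxplus> \<mu> l \<boxplus> l \<otimes> d"
proof -
  let ?t = "inv a \<otimes> \<mu> \<one> \<boxplus> l"
  have "l \<otimes> d \<otimes> inv (srho S d (srho S l a))
      = l \<otimes> (d \<otimes> (inv d \<otimes> (inv l \<otimes> ?t \<otimes> \<mu> \<one> \<boxplus> d)))"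
    using assms by (simp add: inv_srho m_assoc)
  also have "\<dots> = l \<otimes> (inv l \<otimes> (?t \<otimes> \<mu> \<one>) \<boxplus> d)"
    using assms by (simp add: m_assoc [symmetric])
  also have "\<dots> = ?t \<otimes> \<mu> \<one> \<boxplus> \<mu> l \<boxplus> l \<otimes> d"
    using assms by (simp add: mult_inv_mult_splus)
  finally show ?thesis .
qed

lemma srho_srho_eq_iff:
  assumes "a \<in> carrier S" "b \<in> carrier S" "c \<in> carrier S"
  shows "srho S (srho S c b) (srho S (slambda S b c) a) = srho S c (srho S b a) \<longleftrightarrow>
      (inv a \<otimes> \<mu> \<one> \<boxplus> \<mu> b \<boxplus> b \<otimes> c) \<otimes> \<mu> \<one>
        \<boxplus> \<mu> (\<mu> \<one> \<boxplus> \<mu> b \<boxplus> b \<otimes> c) \<boxplus> b \<otimes> c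
      = (inv a \<otimes> \<mu> \<one> \<boxplus> b) \<otimes> \<mu> \<one> \<boxplus> \<mu> b \<boxplus> b \<otimes> c"
    (is "?R = ?L \<longleftrightarrow> ?r = ?l")
proof -
  have L: "b \<otimes> c \<otimes> inv ?L = ?l"
    using assms by (simp add: mult_inv_srho_srho)
  have "b \<otimes> c \<otimes> inv ?R
      = (inv a \<otimes> \<mu> \<one> \<boxplus> slambda S b c) \<otimes> \<mu> \<one> \<boxplus> \<mu> (slambda S b c) \<boxplus> b \<otimes> c"
    using assms mult_inv_srho_srho[of a "slambda S b c" "srho S c b"]
    by (simp add: slambda_mult_srho)
  also have "\<dots> = ?r"
    using assms by (simp add: splus_slambda) (simp add: slambda_eq)
  finally have R: "b \<otimes> c \<otimes> inv ?R = ?r" .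
  have closed: "?R \<in> carrier S" "?L \<in> carrier S"
    using assms by simp_all
  have "?R = ?L \<longleftrightarrow> inv ?R = inv ?L"
    using closed by (metis inv_inv)
  also have "\<dots> \<longleftrightarrow> b \<otimes> c \<otimes> inv ?R = b \<otimes> c \<otimes> inv ?L"
    using closed assms by simp
  finally show ?thesis
    unfolding L R .
qed

text \<open>Comparing third components suffices: the first components always agree, because
  \<open>\<lambda>\<close> is an action and \<open>r\<close> preserves products, and the second ones are then determined by the
  product of the triple.\<close>

lemma semibrace_map_braid_iff:
  assumes a: "a \<in> carrier S" and b: "b \<in> carrier S" and c: "c \<in> carrier S"
  defines "r \<equiv> semibrace_map S"
  shows "(r_times_id r \<circ> id_times_r r \<circ> r_times_id r) (a, b, c)
       = (id_times_r r \<circ> r_times_id r \<circ> id_times_r r) (a, b, c) \<longleftrightarrow>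
     srho S (srho S c b) (srho S (slambda S b c) a) = srho S c (srho S b a)"
proof -
  define u v where "u = slambda S a b" and "v = srho S b a"
  define l d where "l = slambda S b c" and "d = srho S c b"
  define m where "m = slambda S v c"
  define n where "n = srho S l a"
  have carr: "u \<in> carrier S" "v \<in> carrier S" "l \<in> carrier S" "d \<in> carrier S"
      "m \<in> carrier S" "n \<in> carrier S"
    using a b c by (simp_all add: u_def v_def l_def d_def m_def n_def)
  have uv: "u \<otimes> v = a \<otimes> b" and ld: "l \<otimes> d = b \<otimes> c"
    using a b c by (simp_all add: u_def v_def l_def d_def slambda_mult_srho)
  have first: "slambda S u m = slambda S a l"
    using a b c carr by (simp add: m_def l_def slambda_slambda uv)
  have mv: "m \<otimes> srho S c v = v \<otimes> c" and um: "slambda S u m \<otimes> srho S m u = u \<otimes> m"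
    and al: "slambda S a l \<otimes> n = a \<otimes> l" and nd: "slambda S n d \<otimes> srho S d n = n \<otimes> d"
    using a c carr by (simp_all add: m_def n_def slambda_mult_srho)
  have "slambda S u m \<otimes> srho S m u \<otimes> srho S c v = u \<otimes> v \<otimes> c"
    using a b c carr by (simp add: um m_assoc mv)
  also have "\<dots> = a \<otimes> (l \<otimes> d)"
    using a b c by (simp add: uv ld m_assoc)
  also have "\<dots> = slambda S a l \<otimes> n \<otimes> d"
    using a carr by (simp add: al m_assoc)
  also have "\<dots> = slambda S a l \<otimes> (slambda S n d \<otimes> srho S d n)"
    using a carr by (simp add: nd m_assoc)
  finally have "slambda S a l \<otimes> (srho S m u \<otimes> srho S c v)
      = slambda S a l \<otimes> (slambda S n d \<otimes> srho S d n)"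
    using a c carr by (simp add: first m_assoc)
  then have prod: "srho S m u \<otimes> srho S c v = slambda S n d \<otimes> srho S d n"
    using a c carr by simp
  have "srho S m u = slambda S n d" if "srho S d n = srho S c v"
    using prod that c carr by simp
  then show ?thesis
    using first
    by (auto simp: r_def r_times_id_def id_times_r_def semibrace_map_def
        u_def v_def l_def d_def m_def n_def)
qed

end

theorem theorem6p2:
  fixes S :: "('a, 'b) near_semibrace_scheme" (structure)
  assumes "near_left_semibrace S"
  shows "YBE_solution (carrier S) (semibrace_map S) \<longleftrightarrow>
    (\<forall>a \<in> carrier S. \<forall>b \<in> carrier S. \<forall>c \<in> carrier S.
       (a \<otimes> \<mu> \<one> \<boxplus> \<mu> b \<boxplus> b \<otimes> c) \<otimes> \<mu> \<one> \<boxplus> \<mu> (\<mu> \<one> \<boxplus> \<mu> b \<boxplus> b \<otimes> c) \<boxplus> b \<otimes> c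
     = (a \<otimes> \<mu> \<one> \<boxplus> b) \<otimes> \<mu> \<one> \<boxplus> \<mu> b \<boxplus> b \<otimes> c)"
    (is "_ \<longleftrightarrow> (\<forall>a \<in> carrier S. \<forall>b \<in> carrier S. \<forall>c \<in> carrier S. ?E a b c)")
proof -
  interpret near_left_semibrace S by fact
  have "semibrace_map S \<in> carrier S \<times> carrier S \<rightarrow> carrier S \<times> carrier S"
    by (auto simp: semibrace_map_def)
  then have "YBE_solution (carrier S) (semibrace_map S) \<longleftrightarrow>
      (\<forall>a \<in> carrier S. \<forall>b \<in> carrier S. \<forall>c \<in> carrier S. ?E (inv a) b c)"
    unfolding YBE_solution_def
    by (simp add: semibrace_map_braid_iff srho_srho_eq_iff del: comp_apply)
  also have "\<dots> \<longleftrightarrow> (\<forall>a \<in> carrier S. \<forall>b \<in> carrier S. \<forall>c \<in> carrier S. ?E a b c)"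
    by (metis inv_closed inv_inv)
  finally show ?thesis .
qed

end
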